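(* Let $m,p$ be positive integers and $r\in\{0,\ldots,m-1\}$. Write $m=k2^z$ with $k$ odd and $z\ge0$. Let $\overline{\mathcal{T}}=\mathbb{N}\setminus\mathcal{T}$ be the complement of the Thue-Morse set. Then the state complexity of $m\overline{\mathcal{T}}+r=\{mt+r\colon t\in\overline{\mathcal{T}}\}$ with respect to the base $2^p$ is equal to $2k+\left\lceil \frac zp\right\rceil$.
   Context: For an integer $b\ge 2$, let $A_b=\{0,\ldots,b-1\}$. For $w=c_\ell\cdots c_0\in A_b^*$, put $\mathrm{val}_b(w)=\sum_{j=0}^{\ell}c_jb^j$ (most significant digit first; the empty word has value $0$). For $X\subseteq\mathbb{N}$, $\mathrm{val}_b^{-1}(X)=\{w\in A_b^*\colon \mathrm{val}_b(w)\in X\}$. The state complexity of $X$ with respect to the base $b$ is the number of left quotients $w^{-1}L=\{u\in A_b^*\colon wu\in L\}$ ($w\in A_b^*$) of the language $L=\mathrm{val}_b^{-1}(X)$; equivalently, the number of states of the (complete) minimal deterministic automaton of $L$. The Thue-Morse set $\mathcal{T}\subseteq\mathbb{N}$ is the set of natural numbers whose base-$2$ expansion contains an even number of digits $1$. *)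

theory Defs
  imports Complex_Main
begin

definition words :: "nat \<Rightarrow> nat list set" where
  "words b = lists {..<b}"

text \<open>Words are written with the most significant digit first, so the coefficient of
  \<open>b ^ j\<close> is the \<open>j\<close>-th letter counted from the right.\<close>

definition val :: "nat \<Rightarrow> nat list \<Rightarrow> nat" where
  "val b w = (\<Sum>j<length w. (rev w ! j) * b ^ j)"

definition val_lang :: "nat \<Rightarrow> nat set \<Rightarrow> nat list set" where
  "val_lang b X = {w \<in> words b. val b w \<in> X}"

definition left_quotient :: "nat \<Rightarrow> nat list \<Rightarrow> nat list set \<Rightarrow> nat list set" where
  "left_quotient b w L = {u \<in> words b. w @ u \<in> L}"

text \<open>If there were infinitely many left quotients, the value below would be \<open>0\<close> by the
  convention for \<open>card\<close>. A statement that it is positive therefore includes finiteness.\<close>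

definition state_complexity :: "nat \<Rightarrow> nat set \<Rightarrow> nat" where
  "state_complexity b X = card ((\<lambda>w. left_quotient b w (val_lang b X)) ` words b)"

text \<open>\<open>bit n i\<close> says that the coefficient of \<open>2 ^ i\<close> in the binary expansion of \<open>n\<close> is \<open>1\<close>.\<close>

definition thue_morse :: "nat set" where
  "thue_morse = {n. even (card {i. bit n i})}"

end

theory Submission
  imports Defs
begin

text \<open>A left quotient of \<open>val_lang b X\<close> by a word of value \<open>v\<close> depends only on the residual
  of \<open>v\<close>, the set of pairs \<open>(n, y)\<close> with \<open>y < b ^ n\<close> and \<open>v * b ^ n + y \<in> X\<close>.
  Let \<open>X = m T' + r\<close> with \<open>T'\<close> the complement of the Thue-Morse set and \<open>b = 2 ^ p\<close>.
  The levels \<open>n\<close> with \<open>p * n \<ge> z\<close> of the residual determine, and are determined by,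
  \<open>v mod k\<close> and the parity of the digit sum of \<open>v div k\<close>. At a level with \<open>p * n < z\<close>
  the only possible \<open>y\<close> is \<open>r mod b ^ n\<close>, so such a level is either empty or a fixed
  singleton; the least nonempty one, if it exists, determines the whole residual.
  Hence \<open>v\<close> has the same residual as exactly one of the \<open>2 * k\<close> numbers below \<open>2 * k\<close>
  or of the numbers \<open>(m + r) div b ^ n\<close> with \<open>p * n < z\<close>; the latter are the least numbers
  whose level \<open>n\<close> is nonempty, and there are \<open>\<lceil>z / p\<rceil>\<close> of them.\<close>

section \<open>Residuals of numbers\<close>

definition residual :: "nat \<Rightarrow> nat set \<Rightarrow> nat \<Rightarrow> (nat \<times> nat) set" where
  "residual b X v = {(n, y). y < b ^ n \<and> v * b ^ n + y \<in> X}"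

lemma val_Nil [simp]: "val b [] = 0"
  by (simp add: val_def)

lemma val_Cons: "val b (c # w) = c * b ^ length w + val b w"
  by (simp add: val_def nth_append)

lemma val_append: "val b (w @ u) = val b w * b ^ length u + val b u"
  by (induction w) (simp_all add: val_Cons algebra_simps power_add)

lemma val_less:
  assumes "w \<in> words b"
  shows "val b w < b ^ length w"
  using assms
proof (induction w)
  case (Cons c w)
  then have "Suc c \<le> b" and "val b w < b ^ length w"
    by (auto simp: words_def)
  then have "val b (c # w) < Suc c * b ^ length w"
    by (simp add: val_Cons)
  also have "\<dots> \<le> b * b ^ length w"
    using \<open>Suc c \<le> b\<close> by (rule mult_right_mono) simp
  finally show ?case by simp
qed simp

lemma ex_word_val:
  assumes "y < b ^ n"
  shows "\<exists>w \<in> words b. length w = n \<and> val b w = y"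
  using assms
proof (induction n arbitrary: y)
  case (Suc n)
  then have "0 < b ^ n" "y div b ^ n < b"
    by (auto simp: less_mult_imp_div_less intro: gr0I)
  moreover from \<open>0 < b ^ n\<close> obtain w where "w \<in> words b" "length w = n" "val b w = y mod b ^ n"
    using Suc.IH[of "y mod b ^ n"] by auto
  ultimately show ?case
    by (intro bexI[of _ "(y div b ^ n) # w"]) (auto simp: val_Cons words_def div_mult_mod_eq)
qed (auto simp: words_def)

lemma val_words_surj:
  assumes "b \<ge> 2"
  shows "val b ` words b = UNIV"
proof -
  have "v \<in> val b ` words b" for v
  proof -
    \<comment> \<open>Any length that admits the value \<open>v\<close> will do, and
      \<open>v\<close> itself is one; leading zeros do no harm.\<close>
    have "v < b ^ v"
      using assms by (meson less_exp order_less_le_trans power_mono zero_le)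
    then show ?thesis
      using ex_word_val[of v b v] by (force simp: image_iff)
  qed
  then show ?thesis by blast
qed

lemma state_complexity_eq_card_residuals:
  assumes "b \<ge> 2"
  shows "state_complexity b X = card (range (residual b X))"
proof -
  \<comment> \<open>On residuals \<open>g\<close> is injective: each pair in a residual is the
    length and value of some word.\<close>
  define g where "g S = {u \<in> words b. (length u, val b u) \<in> S}" for S
  have "left_quotient b w (val_lang b X) = g (residual b X (val b w))" if "w \<in> words b" for w
    using that val_less
    by (auto simp: left_quotient_def val_lang_def g_def residual_def val_append words_def)
  then have "(\<lambda>w. left_quotient b w (val_lang b X)) ` words b
      = (\<lambda>w. g (residual b X (val b w))) ` words b"
    by (rule image_cong[OF refl])
  also have "\<dots> = g ` residual b X ` val b ` words b"
    by (simp add: image_image)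
  also have "\<dots> = g ` range (residual b X)"
    by (simp only: val_words_surj[OF assms])
  finally have "state_complexity b X = card (g ` range (residual b X))"
    by (simp add: state_complexity_def)
  moreover have sub: "residual b X v \<subseteq> residual b X v'"
    if "g (residual b X v) = g (residual b X v')" for v v'
  proof
    fix a assume a: "a \<in> residual b X v"
    obtain n y where [simp]: "a = (n, y)" by fastforce
    from a have "y < b ^ n" by (simp add: residual_def)
    then obtain u where u: "u \<in> words b" "length u = n" "val b u = y"
      using ex_word_val by blast
    then have "u \<in> g (residual b X v)" using a by (simp add: g_def)
    then have "u \<in> g (residual b X v')" by (simp only: that)
    then show "a \<in> residual b X v'" using u by (simp add: g_def)
  qed
  have "inj_on g (range (residual b X))"
  proof (rule inj_onI, elim rangeE)
    fix S S' v v'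
    assume "g S = g S'" and "S = residual b X v" "S' = residual b X v'"
    then show "S = S'"
      using sub[of v v'] sub[of v' v] by simp
  qed
  ultimately show ?thesis
    by (simp add: card_image)
qed

section \<open>Parity of the binary digit sum\<close>

definition odd_ones :: "nat \<Rightarrow> bool" where
  "odd_ones n \<longleftrightarrow> odd (card {i. bit n i})"

lemma odd_ones_0 [simp]: "\<not> odd_ones 0"
  by (simp add: odd_ones_def)

lemma finite_bit_nat: "finite {i. bit (n::nat) i}"
proof (rule finite_subset)
  show "{i. bit n i} \<subseteq> {..<n}"
  proof
    fix i assume "i \<in> {i. bit n i}"
    then have "n div 2 ^ i \<noteq> 0" by (auto simp: bit_iff_odd intro: Nat.gr0I)
    then have "2 ^ i \<le> n" by (simp add: div_eq_0_iff)
    then show "i \<in> {..<n}" using order_less_le_trans[OF less_exp] by blast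
  qed
qed simp

lemma odd_ones_double [simp]: "odd_ones (2 * n) \<longleftrightarrow> odd_ones n"
proof -
  have "{i. bit (2 * n) i} = Suc ` {i. bit n i}"
    by (auto simp: bit_double_iff image_iff gr0_conv_Suc)
  then show ?thesis
    by (simp add: odd_ones_def card_image)
qed

lemma odd_ones_Suc_double [simp]: "odd_ones (Suc (2 * n)) \<longleftrightarrow> \<not> odd_ones n"
proof -
  have "bit (Suc (2 * n)) i \<longleftrightarrow> i = 0 \<or> (\<exists>j. i = Suc j \<and> bit n j)" for i
    by (cases i) (simp_all add: bit_0 bit_Suc)
  then have "{i. bit (Suc (2 * n)) i} = insert 0 (Suc ` {i. bit n i})"
    by auto
  then show ?thesis
    by (simp add: odd_ones_def card_image finite_bit_nat)
qed

lemma odd_ones_1 [simp]: "odd_ones (Suc 0)"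
  using odd_ones_Suc_double[of 0] by simp

text \<open>No carry occurs, since the digits of \<open>s\<close> occupy places below
  \<open>N\<close>; so digit sums add up and parities combine by exclusive or. The induction strips
  the last digit of \<open>s\<close>.\<close>

lemma odd_ones_append:
  assumes "s < 2 ^ N"
  shows "odd_ones (a * 2 ^ N + s) \<longleftrightarrow> odd_ones a \<noteq> odd_ones s"
  using assms
proof (induction N arbitrary: s)
  case (Suc N)
  have IH: "odd_ones (a * 2 ^ N + s div 2) \<longleftrightarrow> odd_ones a \<noteq> odd_ones (s div 2)"
    using Suc by (intro Suc.IH) auto
  show ?case
  proof (cases "even s")
    case True
    then have "s = 2 * (s div 2)" by simp
    then obtain h where "s = 2 * h" "s div 2 = h" by blast
    moreover from this have "a * 2 ^ Suc N + s = 2 * (a * 2 ^ N + h)" by simp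
    ultimately show ?thesis using IH by (simp only: odd_ones_double)
  next
    case False
    then have "s = Suc (2 * (s div 2))" by simp
    then obtain h where "s = Suc (2 * h)" "s div 2 = h" by blast
    moreover from this have "a * 2 ^ Suc N + s = Suc (2 * (a * 2 ^ N + h))" by simp
    ultimately show ?thesis using IH by (simp only: odd_ones_Suc_double) blast
  qed
qed simp

section \<open>Multiples of the complement of the Thue-Morse set\<close>

definition tm_multiples :: "nat \<Rightarrow> nat \<Rightarrow> nat set" where
  "tm_multiples m r = {m * t + r | t. t \<in> - thue_morse}"

lemma tm_multiples_iff:
  assumes "r < m"
  shows "x \<in> tm_multiples m r \<longleftrightarrow> x mod m = r \<and> odd_ones (x div m)"
proof -
  have "x = m * (x div m) + r" if "x mod m = r"
    using that mult_div_mod_eq[of m x] by simp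
  then show ?thesis
    using assms by (auto simp: tm_multiples_def thue_morse_def odd_ones_def)
qed

text \<open>Division by \<open>m\<close> gives \<open>t * 2 ^ e + x div m\<close> with
  \<open>x div m < 2 ^ e\<close>, so \<open>odd_ones_append\<close> separates the digits of
  \<open>t\<close> from those of \<open>x div m\<close>.\<close>

lemma tm_multiples_append_iff:
  assumes "r < m" and "x < m * 2 ^ e"
  shows "m * (t * 2 ^ e) + x \<in> tm_multiples m r \<longleftrightarrow>
    x mod m = r \<and> odd_ones t \<noteq> odd_ones (x div m)"
proof -
  have "x div m < 2 ^ e"
    using assms by (intro less_mult_imp_div_less) (simp add: mult.commute)
  moreover have "(m * (t * 2 ^ e) + x) div m = t * 2 ^ e + x div m"
    using assms by simp
  ultimately show ?thesis
    using assms by (simp add: tm_multiples_iff odd_ones_append)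
qed

section \<open>Setting, and levels with \<open>z \<le> p * n\<close>\<close>

locale tm_setup =
  fixes m p r k z :: nat
  assumes m_pos: "m > 0" and p_pos: "p > 0" and r_less: "r < m"
    and m_eq: "m = k * 2 ^ z" and odd_k: "odd k"
begin

abbreviation "X \<equiv> tm_multiples m r"

abbreviation "res \<equiv> residual (2 ^ p) X"

lemma k_pos: "k > 0"
  using odd_k by (rule odd_pos)

lemma mem_res_iff: "(n, y) \<in> res v \<longleftrightarrow> y < 2 ^ (p * n) \<and> v * 2 ^ (p * n) + y \<in> X"
  by (simp add: residual_def power_mult)

text \<open>Here \<open>2 ^ z\<close> divides \<open>2 ^ (p * n)\<close>, so the multiple of
  \<open>k\<close> in \<open>v\<close> becomes a multiple of \<open>m\<close> and splits off by
  \<open>tm_multiples_append_iff\<close>.\<close>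

lemma mem_res_large_iff:
  fixes v n y :: nat
  assumes "z \<le> p * n" and "y < 2 ^ (p * n)"
  defines "x \<equiv> (v mod k) * 2 ^ (p * n) + y"
  shows "(n, y) \<in> res v \<longleftrightarrow> x mod m = r \<and> odd_ones (v div k) \<noteq> odd_ones (x div m)"
proof -
  have b: "2 ^ (p * n) = (2::nat) ^ z * 2 ^ (p * n - z)"
    using assms(1) by (simp flip: power_add)
  have "x < Suc (v mod k) * 2 ^ (p * n)"
    using assms(2) by (simp add: x_def)
  also have "\<dots> \<le> k * 2 ^ (p * n)"
    using k_pos by (intro mult_right_mono) (simp_all add: Suc_leI)
  finally have x: "x < m * 2 ^ (p * n - z)"
    by (simp add: m_eq b)
  have "v * 2 ^ (p * n) + y = (k * (v div k) + v mod k) * 2 ^ (p * n) + y"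
    by simp
  also have "\<dots> = (v div k) * k * 2 ^ (p * n) + x"
    by (simp only: x_def distrib_left distrib_right ac_simps)
  also have "\<dots> = m * ((v div k) * 2 ^ (p * n - z)) + x"
    by (simp add: m_eq b)
  finally show ?thesis
    using assms(2) tm_multiples_append_iff[OF r_less x] by (simp add: mem_res_iff)
qed

section \<open>Levels with \<open>p * n < z\<close>\<close>

definition hits :: "nat \<Rightarrow> nat \<Rightarrow> bool" where
  "hits n v \<longleftrightarrow> p * n < z \<and> (\<exists>y. (n, y) \<in> res v)"

text \<open>Here \<open>2 ^ (p * n)\<close> divides \<open>m\<close>, so all elements of
  \<open>X\<close> are congruent to \<open>r\<close> modulo \<open>2 ^ (p * n)\<close>.\<close>

lemma mem_res_small:
  assumes "p * n < z" and "(n, y) \<in> res v"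
  shows "y = r mod 2 ^ (p * n)"
proof -
  from assms have y: "y < 2 ^ (p * n)" and "v * 2 ^ (p * n) + y \<in> X"
    by (simp_all add: mem_res_iff)
  then have "(v * 2 ^ (p * n) + y) mod m = r"
    using r_less by (simp add: tm_multiples_iff)
  moreover have "2 ^ (p * n) dvd m"
    using assms(1) by (simp add: m_eq le_imp_power_dvd dvd_mult)
  ultimately have "r mod 2 ^ (p * n) = (v * 2 ^ (p * n) + y) mod 2 ^ (p * n)"
    using mod_mod_cancel by metis
  then show ?thesis using y by simp
qed

lemma mem_res_small_iff:
  assumes "p * n < z"
  shows "(n, y) \<in> res v \<longleftrightarrow> hits n v \<and> y = r mod 2 ^ (p * n)"
  using assms mem_res_small unfolding hits_def by blast

lemma hitsE:
  assumes "hits n v"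
  obtains t where "odd_ones t" "v = (m * t + r) div 2 ^ (p * n)"
proof -
  from assms obtain y where "y < 2 ^ (p * n)" "v * 2 ^ (p * n) + y \<in> X"
    by (auto simp: hits_def mem_res_iff)
  then obtain t where t: "odd_ones t" "v * 2 ^ (p * n) + y = m * t + r"
    by (auto simp: tm_multiples_def thue_morse_def odd_ones_def)
  moreover have "v = (v * 2 ^ (p * n) + y) div 2 ^ (p * n)"
    using \<open>y < _\<close> by simp
  ultimately show thesis using that by simp
qed

lemma hits_least:
  assumes "p * n < z"
  shows "hits n ((m + r) div 2 ^ (p * n))"
proof -
  have "((m + r) div 2 ^ (p * n)) * 2 ^ (p * n) + (m + r) mod 2 ^ (p * n) = m + r"
    by (rule div_mult_mod_eq)
  moreover have "m + r \<in> X"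
    using r_less m_pos by (simp add: tm_multiples_iff)
  ultimately have "(n, (m + r) mod 2 ^ (p * n)) \<in> res ((m + r) div 2 ^ (p * n))"
    by (simp add: mem_res_iff)
  then show ?thesis
    using assms unfolding hits_def by blast
qed

text \<open>The smallest number with odd digit sum is 1, so \<open>m + r\<close> is the least
  element of \<open>X\<close>; dropping final digits is monotone.\<close>

lemma hits_ge:
  assumes "hits n v"
  shows "(m + r) div 2 ^ (p * n) \<le> v"
proof -
  from assms obtain t where t: "odd_ones t" "v = (m * t + r) div 2 ^ (p * n)"
    by (rule hitsE)
  then have "t \<ge> 1" by (cases t) auto
  then have "m + r \<le> m * t + r" by simp
  then show ?thesis using t by (simp add: div_le_mono)
qed

lemma least_ge:
  assumes "p * n < z"
  shows "2 * k \<le> (m + r) div 2 ^ (p * n)"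
proof -
  \<comment> \<open>The strict inequality \<open>p * n < z\<close> leaves a spare factor 2, which
    turns the bound \<open>k\<close> into \<open>2 * k\<close>.\<close>
  have "2 ^ Suc (p * n) \<le> (2::nat) ^ z"
    using assms by (intro power_increasing) auto
  then have "k * 2 ^ Suc (p * n) \<le> k * 2 ^ z"
    by (rule mult_le_mono2)
  also have "\<dots> \<le> m + r"
    by (simp add: m_eq)
  finally have "2 * k * 2 ^ (p * n) \<le> m + r"
    by (simp add: mult_ac)
  then show ?thesis by (simp add: less_eq_div_iff_mult_less_eq)
qed

lemma least_strict_antimono:
  assumes "n < n'" and "p * n' < z"
  shows "(m + r) div 2 ^ (p * n') < (m + r) div 2 ^ (p * n)"
proof -
  have "p * n < p * n'" using assms p_pos by simp
  then obtain d where d: "p * n' = p * n + Suc d"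
    using less_imp_Suc_add by fastforce
  define q where "q = (m + r) div 2 ^ (p * n)"
  have "p * n < z" using \<open>p * n < p * n'\<close> assms(2) by (rule less_trans)
  then have "q > 0"
    using least_ge[of n] k_pos by (simp add: q_def)
  have "(m + r) div 2 ^ (p * n') = q div 2 ^ Suc d"
    by (simp only: d q_def power_add div_mult2_eq)
  also have "\<dots> < q"
    using \<open>q > 0\<close> by (intro div_less_dividend one_less_power) auto
  finally show ?thesis by (simp add: q_def)
qed

text \<open>Since the right-hand side does not mention \<open>v\<close>, all numbers that hit level \<open>n\<close> have
  the same residual from level \<open>n\<close> on.\<close>

lemma mem_res_after_hit_iff:
  fixes n n' y :: nat
  assumes "hits n v" and "n \<le> n'" and "y < 2 ^ (p * n')"
  defines "x \<equiv> (r div 2 ^ (p * n)) * 2 ^ (p * n') + y"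
  shows "(n', y) \<in> res v \<longleftrightarrow> x mod m = r \<and> \<not> odd_ones (x div m)"
proof -
  define a where "a = p * n"
  have "a \<le> z" using assms(1) by (simp add: a_def hits_def)
  define e where "e = p * n' - a"
  have n': "p * n' = a + e" using assms(2) by (simp add: a_def e_def)
  define l where "l = k * 2 ^ (z - a)"
  have m: "m = l * 2 ^ a"
    using \<open>a \<le> z\<close> by (simp add: l_def m_eq flip: power_add)
  from assms(1) obtain t where t: "odd_ones t" "v = (m * t + r) div 2 ^ a"
    unfolding a_def by (rule hitsE)
  have "v = (r + (l * t) * 2 ^ a) div 2 ^ a"
    by (simp add: t m ac_simps)
  then have v: "v = l * t + r div 2 ^ a"
    by simp
  have "r div 2 ^ a < l"
    using r_less by (intro less_mult_imp_div_less) (simp add: m)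
  have "x < Suc (r div 2 ^ a) * 2 ^ (p * n')"
    using assms(3) by (simp add: x_def a_def)
  also have "\<dots> \<le> l * 2 ^ (p * n')"
    using \<open>r div 2 ^ a < l\<close> by (intro mult_right_mono) auto
  finally have x: "x < m * 2 ^ e"
    by (simp add: m n' power_add)
  have "v * 2 ^ (p * n') + y = l * t * 2 ^ (p * n') + x"
    by (simp add: v x_def a_def algebra_simps)
  \<comment> \<open>The unknown \<open>t\<close> now enters only through the parity of its digit
    sum, which is odd.\<close>
  also have "\<dots> = m * (t * 2 ^ e) + x"
    by (simp add: m n' power_add)
  finally show ?thesis
    using assms(3) t tm_multiples_append_iff[OF r_less x] by (simp add: mem_res_iff)
qed

text \<open>Below level \<open>n\<close> both numbers miss every level, the right-hand one because
  it is too small by \<open>hits_ge\<close>; from level \<open>n\<close> on,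
  \<open>mem_res_after_hit_iff\<close> gives both the same condition.\<close>

lemma res_eq_least:
  assumes "hits n v" and "\<And>n'. n' < n \<Longrightarrow> \<not> hits n' v"
  shows "res v = res ((m + r) div 2 ^ (p * n))"
proof -
  let ?u = "(m + r) div 2 ^ (p * n)"
  have n: "p * n < z" using assms(1) by (simp add: hits_def)
  have "(n', y) \<in> res v \<longleftrightarrow> (n', y) \<in> res ?u" for n' y
  proof (cases "n' < n")
    case True
    then have "p * n' < z"
      using n by (meson le_less_trans less_imp_le mult_le_mono2)
    moreover have "\<not> hits n' ?u"
      using hits_ge[of n' ?u] least_strict_antimono[OF True n] by auto
    ultimately show ?thesis
      using assms(2)[OF True] by (simp add: mem_res_small_iff)
  next
    case False
    show ?thesis
    proof (cases "y < 2 ^ (p * n')")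
      case True
      with False show ?thesis
        using mem_res_after_hit_iff[OF assms(1)] mem_res_after_hit_iff[OF hits_least[OF n]]
        by simp
    qed (simp add: mem_res_iff)
  qed
  then show ?thesis by (auto simp del: split_paired_All)
qed

section \<open>Representatives below \<open>2 * k\<close>\<close>

lemma not_hits_small:
  assumes "v < 2 * k"
  shows "\<not> hits n v"
proof
  assume h: "hits n v"
  then have "2 * k \<le> (m + r) div 2 ^ (p * n)"
    by (intro least_ge) (simp add: hits_def)
  with hits_ge[OF h] assms show False by linarith
qed

lemma res_eq_small:
  assumes "\<And>n. \<not> hits n v"
  shows "\<exists>u < 2 * k. res v = res u"
proof -
  \<comment> \<open>The quotient of \<open>v\<close> by \<open>k\<close> is replaced by 0 or 1,
    whichever has the same digit-sum parity; the remainder is kept.\<close>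
  define u where "u = k * of_bool (odd_ones (v div k)) + v mod k"
  have "u \<le> k + v mod k"
    by (simp add: u_def)
  with mod_less_divisor[OF k_pos, of v] have u_less: "u < 2 * k"
    by linarith
  have u_div: "u div k = of_bool (odd_ones (v div k))" and u_mod: "u mod k = v mod k"
    using k_pos by (simp_all add: u_def)
  have "(n, y) \<in> res v \<longleftrightarrow> (n, y) \<in> res u" for n y
  proof (cases "p * n < z")
    case True
    then show ?thesis
      using assms not_hits_small[OF u_less] by (simp add: mem_res_small_iff)
  next
    case False
    show ?thesis
    proof (cases "y < 2 ^ (p * n)")
      case True
      with False show ?thesis
        by (simp add: mem_res_large_iff u_div u_mod)
    qed (simp add: mem_res_iff)
  qed
  then have "res v = res u" by auto
  with u_less show ?thesis by blast
qed

text \<open>If \<open>2 ^ (p * n) \<ge> 4 * m\<close>, the interval of length \<open>2 ^ (p * n)\<close> that starts at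
  \<open>(u mod k) * 2 ^ (p * n)\<close> contains \<open>m * s + r\<close> for two consecutive numbers
  \<open>s = 2 * a\<close> and \<open>s = 2 * a + 1\<close>, whose digit sums have different parities.\<close>

lemma ex_mem_res_large:
  assumes "z \<le> p * n" and "4 * m \<le> 2 ^ (p * n)"
  shows "\<exists>y. (n, y) \<in> res u"
proof -
  define c where "c = (u mod k) * 2 ^ (p * n)"
  define a where "a = Suc (c div (2 * m))"
  have a: "c < 2 * m * a" "2 * m * a \<le> c + 2 * m"
    using m_pos dividend_less_times_div[of "2 * m" c] times_div_less_eq_dividend[of "2 * m" c]
    by (simp_all add: a_def)
  define s where "s = 2 * a + of_bool (odd_ones a = odd_ones (u div k))"
  have s: "odd_ones s \<noteq> odd_ones (u div k)"
    by (auto simp: s_def)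
  have "m * (2 * a) \<le> m * s" "m * s \<le> m * (2 * a + 1)"
    by (intro mult_le_mono2; simp add: s_def)+
  moreover have "m * (2 * a) = 2 * m * a" "m * (2 * a + 1) = 2 * m * a + m"
    by (simp_all add: algebra_simps)
  ultimately have c_le: "c \<le> m * s + r" and less: "m * s + r - c < 2 ^ (p * n)"
    using a r_less assms(2) by linarith+
  have "(n, m * s + r - c) \<in> res u"
    using mem_res_large_iff[OF assms(1) less, of u] c_le r_less s by (simp add: c_def[symmetric])
  then show ?thesis by blast
qed

text \<open>A shared element \<open>y\<close> of one large level makes the two values
  \<open>?x\<close> agree modulo \<open>m\<close>, hence modulo \<open>k\<close>; the power of 2
  cancels because \<open>k\<close> is odd.\<close>

lemma res_small_inj:
  assumes "u < 2 * k" and "u' < 2 * k" and eq: "res u = res u'"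
  shows "u = u'"
proof -
  \<comment> \<open>Large enough for both \<open>z \<le> p * n\<close> and
    \<open>4 * m \<le> 2 ^ (p * n)\<close>.\<close>
  define n where "n = z + 4 * m"
  have pn: "n \<le> p * n" using p_pos by simp
  then have zn: "z \<le> p * n" using n_def by linarith
  have "4 * m \<le> 2 ^ (4 * m)" by (rule less_imp_le) (rule less_exp)
  also have "\<dots> \<le> 2 ^ (p * n)"
    using pn n_def by (intro power_increasing) linarith+
  finally obtain y where y: "(n, y) \<in> res u"
    using ex_mem_res_large[OF zn] by blast
  then have yb: "y < 2 ^ (p * n)" by (simp add: mem_res_iff)
  have y': "(n, y) \<in> res u'" using y eq by simp
  let ?x = "\<lambda>u. (u mod k) * 2 ^ (p * n) + y"
  have 1: "?x u mod m = r" "odd_ones (u div k) \<noteq> odd_ones (?x u div m)"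
    using y mem_res_large_iff[OF zn yb] by blast+
  have 2: "?x u' mod m = r" "odd_ones (u' div k) \<noteq> odd_ones (?x u' div m)"
    using y' mem_res_large_iff[OF zn yb] by blast+
  have "int (?x u) mod int m = int (?x u') mod int m"
    using 1 2 by (metis zmod_int)
  then have "int m dvd int (?x u) - int (?x u')"
    by (simp only: mod_eq_dvd_iff)
  moreover have "int k dvd int m" by (simp add: m_eq)
  ultimately have "int k dvd int (?x u) - int (?x u')"
    by (rule dvd_trans[rotated])
  then have "int k dvd (int (u mod k) - int (u' mod k)) * 2 ^ (p * n)"
    by (simp add: left_diff_distrib)
  moreover have "coprime (int k) (2 ^ (p * n))"
    using odd_k by simp
  ultimately have "int k dvd int (u mod k) - int (u' mod k)"
    by (simp add: coprime_dvd_mult_left_iff)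
  then have "int (u mod k) mod int k = int (u' mod k) mod int k"
    by (simp only: mod_eq_dvd_iff)
  then have mod: "u mod k = u' mod k"
    by (simp flip: of_nat_mod)
  \<comment> \<open>Equal remainders make the two values \<open>?x\<close> equal, so both parities
    differ from the same one.\<close>
  then have "odd_ones (u div k) = odd_ones (u' div k)"
    using 1 2 by auto
  moreover have "u div k < 2" "u' div k < 2"
    using assms(1,2) by (auto intro: less_mult_imp_div_less)
  ultimately have "u div k = u' div k"
    by (auto simp: less_2_cases_iff)
  with mod show ?thesis
    by (metis mult_div_mod_eq)
qed

section \<open>Counting the residuals\<close>

definition least_hits :: "nat set" where
  "least_hits = (\<lambda>n. (m + r) div 2 ^ (p * n)) ` {n. p * n < z}"

lemma range_res: "range res = res ` ({..<2 * k} \<union> least_hits)"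
proof -
  have "res v \<in> res ` ({..<2 * k} \<union> least_hits)" for v
  proof (cases "\<exists>n. hits n v")
    case True
    define n where "n = (LEAST n. hits n v)"
    have n: "hits n v"
      unfolding n_def using True by (rule LeastI_ex)
    then have "res v = res ((m + r) div 2 ^ (p * n))"
      using not_less_Least unfolding n_def by (intro res_eq_least) blast+
    moreover have "p * n < z" using n by (simp add: hits_def)
    ultimately show ?thesis by (auto simp: least_hits_def)
  next
    case False
    then show ?thesis using res_eq_small[of v] by auto
  qed
  then show ?thesis by blast
qed

lemma res_neq_least:
  assumes "p * n < z" and "v < (m + r) div 2 ^ (p * n)"
  shows "res v \<noteq> res ((m + r) div 2 ^ (p * n))"
proof
  assume "res v = res ((m + r) div 2 ^ (p * n))"
  then have "hits n v"
    using hits_least[OF assms(1)] by (simp only: hits_def)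
  then show False
    using hits_ge[of n v] assms(2) by simp
qed

text \<open>The larger of two candidates decides: below \<open>2 * k\<close>,
  \<open>res_small_inj\<close> applies; otherwise it is the least number hitting some level, which
  the smaller one misses.\<close>

lemma inj_on_res: "inj_on res ({..<2 * k} \<union> least_hits)"
proof (rule linorder_inj_onI)
  fix u v assume "u < v" and "u \<in> {..<2 * k} \<union> least_hits" "v \<in> {..<2 * k} \<union> least_hits"
  then show "res u \<noteq> res v"
  proof (cases "v < 2 * k")
    case True
    then show ?thesis using \<open>u < v\<close> res_small_inj[of u v] by auto
  next
    case False
    then show ?thesis
      using \<open>u < v\<close> \<open>v \<in> _\<close> res_neq_least by (auto simp: least_hits_def)
  qed
qed auto

lemma small_levels: "{n. p * n < z} = {..<nat \<lceil>real z / real p\<rceil>}"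
proof -
  have "p * n < z \<longleftrightarrow> n < nat \<lceil>real z / real p\<rceil>" for n
  proof -
    have "p * n < z \<longleftrightarrow> real p * real n < real z"
      by (simp flip: of_nat_mult)
    also have "\<dots> \<longleftrightarrow> real n < real z / real p"
      using p_pos by (simp add: pos_less_divide_eq mult.commute)
    also have "\<dots> \<longleftrightarrow> n < nat \<lceil>real z / real p\<rceil>"
      by (simp add: zless_nat_eq_int_zless less_ceiling_iff)
    finally show ?thesis .
  qed
  then show ?thesis by blast
qed

lemma state_complexity_tm_multiples:
  "state_complexity (2 ^ p) X = 2 * k + nat \<lceil>real z / real p\<rceil>"
proof -
  have "(2::nat) ^ p \<ge> 2 ^ 1"
    using p_pos by (intro power_increasing) auto
  then have "state_complexity (2 ^ p) X = card (range res)"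
    by (intro state_complexity_eq_card_residuals) simp
  also have "\<dots> = card ({..<2 * k} \<union> least_hits)"
    unfolding range_res using inj_on_res by (rule card_image)
  also have "\<dots> = 2 * k + card least_hits"
  proof (subst card_Un_disjoint)
    show "finite least_hits" by (simp add: least_hits_def small_levels)
    show "{..<2 * k} \<inter> least_hits = {}"
      using least_ge by (fastforce simp: least_hits_def)
  qed auto
  also have "card least_hits = card {n. p * n < z}"
    unfolding least_hits_def
  proof (intro card_image linorder_inj_onI)
    fix i j assume "i < j" "j \<in> {n. p * n < z}"
    then show "(m + r) div 2 ^ (p * i) \<noteq> (m + r) div 2 ^ (p * j)"
      using least_strict_antimono[of i j] by simp
  qed auto
  finally show ?thesis
    by (simp add: small_levels)
qed

end

theorem corollary52:
  fixes m p r k z :: nat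
  assumes "m > 0" and "p > 0" and "r < m"
    and "m = k * 2 ^ z" and "odd k"
  shows "int (state_complexity (2 ^ p) {m * t + r | t. t \<in> - thue_morse})
           = 2 * int k + \<lceil>real z / real p\<rceil>"
proof -
  interpret tm_setup m p r k z
    using assms by unfold_locales
  have "state_complexity (2 ^ p) {m * t + r | t. t \<in> - thue_morse}
      = 2 * k + nat \<lceil>real z / real p\<rceil>"
    using state_complexity_tm_multiples by (simp only: tm_multiples_def)
  moreover have "0 \<le> \<lceil>real z / real p\<rceil>"
    by (rule order.trans[OF _ ceiling_mono[of 0]]) simp_all
  ultimately show ?thesis by simp
qed

end
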